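(* Let $\alpha\in\mathbb{N}$ and let $\{\Upsilon_{j,k} \mid j\in\mathbb{N},\,k\in \{1,\dots,\alpha\}\}$ be nonnegative real numbers. If $$\sum_{j=1}^\infty\sum_{k=1}^\alpha \Upsilon_{j,k}^{1/k}<\infty,$$ then $$\sum_{v\subseteq \mathbb{N}} m^{|v|}\sum_{\boldsymbol{\nu}\in \{1,\dots,\alpha\}^{|v|}}|\boldsymbol{\nu}|!\prod_{j\in v} \Upsilon_{j,\nu_j}<\infty \text{ for all real } m>0.$$
   Context: $\mathbb{N}=\{1,2,3,\dots\}$. Sums over $v\subseteq\mathbb{N}$ run over all finite subsets of $\mathbb{N}$, including the empty set. For a finite set $v\subseteq\mathbb{N}$, a multi-index $\boldsymbol{\nu}\in\{1,\dots,\alpha\}^{|v|}$ is indexed by the elements of $v$, i.e. $\boldsymbol{\nu}=(\nu_j)_{j\in v}$ with each $\nu_j\in\{1,\dots,\alpha\}$, and $|\boldsymbol{\nu}|=\sum_{j\in v}\nu_j$. The term for $v=\emptyset$ equals $1$. *)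

theory Defs
  imports "HOL-Analysis.Analysis" "HOL-Library.FuncSet"
begin

text \<open>Multi-indices are extensional functions on \<open>v\<close>, so each one is counted once;
  for \<open>v = {}\<close> there is exactly one.\<close>

definition multi_indices :: "nat \<Rightarrow> nat set \<Rightarrow> (nat \<Rightarrow> nat) set" where
  "multi_indices \<alpha> v = v \<rightarrow>\<^sub>E {1..\<alpha>}"

end

theory Submission
  imports Defs
begin

text \<open>Absorb \<open>m\<close> into \<open>a j k = m * \<Upsilon> j k\<close> and generalise \<open>fact \<bar>\<nu>\<bar>\<close> to \<open>fact (s + \<bar>\<nu>\<bar>)\<close>.
  The partial sums \<open>T s F\<close> over \<open>v \<subseteq> F\<close> then satisfy
  \<open>T s (F \<union> {j}) = T s F + (\<Sum>k=1..\<alpha>. a j k * T (s + k) F)\<close>.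
  If \<open>a j k \<le> b j ^ k\<close> and \<open>x = 1 - \<alpha> * sum b F > 0\<close>, this recursion and the negative binomial
  series give \<open>T s F \<le> fact s / x ^ (s + 1)\<close>; the bound is the value of the integral of
  \<open>t ^ s * exp (- x * t)\<close> over \<open>t > 0\<close>. With \<open>b j\<close> a multiple of \<open>\<Sum>k. \<Upsilon> j k powr (1/k)\<close>, it
  applies to all finite \<open>F\<close> avoiding a fixed finite set, and the finitely many exceptional
  indices are added back by the recursion.\<close>

definition weight :: "nat \<Rightarrow> (nat \<Rightarrow> nat \<Rightarrow> real) \<Rightarrow> nat \<Rightarrow> nat set \<Rightarrow> real" where
  "weight \<alpha> a s v = (\<Sum>\<nu>\<in>multi_indices \<alpha> v. fact (s + (\<Sum>j\<in>v. \<nu> j)) * (\<Prod>j\<in>v. a j (\<nu> j)))"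

definition total_weight :: "nat \<Rightarrow> (nat \<Rightarrow> nat \<Rightarrow> real) \<Rightarrow> nat \<Rightarrow> nat set \<Rightarrow> real" where
  "total_weight \<alpha> a s F = (\<Sum>v\<in>Pow F. weight \<alpha> a s v)"

lemma weight_nonneg:
  assumes "\<And>j k. j \<in> v \<Longrightarrow> k \<in> {1..\<alpha>} \<Longrightarrow> a j k \<ge> 0"
  shows "weight \<alpha> a s v \<ge> 0"
  unfolding weight_def multi_indices_def
  by (intro sum_nonneg mult_nonneg_nonneg prod_nonneg) (use assms in \<open>auto simp: PiE_def Pi_def\<close>)

text \<open>Split a multi-index on \<open>insert j v\<close> into its value \<open>k\<close> at
  \<open>j\<close> and its restriction to \<open>v\<close>. The value \<open>k\<close> joins the
  shift \<open>s\<close> inside the factorial, so the family of all shifts is closed under the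
  recursion.\<close>

lemma weight_insert:
  assumes "finite v" "j \<notin> v"
  shows "weight \<alpha> a s (insert j v) = (\<Sum>k=1..\<alpha>. a j k * weight \<alpha> a (s + k) v)"
proof -
  let ?f = "\<lambda>(k, g). g(j := k)"
  let ?h = "\<lambda>\<nu>. fact (s + (\<Sum>i\<in>insert j v. \<nu> i)) * (\<Prod>i\<in>insert j v. a i (\<nu> i))"
  have val: "?h (g(j := k)) = a j k * (fact (s + k + (\<Sum>i\<in>v. g i)) * (\<Prod>i\<in>v. a i (g i)))" for g k
  proof -
    have "(\<Sum>i\<in>v. (g(j := k)) i) = (\<Sum>i\<in>v. g i)" "(\<Prod>i\<in>v. a i ((g(j := k)) i)) = (\<Prod>i\<in>v. a i (g i))"
      using assms by (auto intro!: sum.cong prod.cong)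
    then show ?thesis
      using assms by (simp add: add_ac)
  qed
  have "weight \<alpha> a s (insert j v) = sum ?h (?f ` ({1..\<alpha>} \<times> (v \<rightarrow>\<^sub>E {1..\<alpha>})))"
    unfolding weight_def multi_indices_def PiE_insert_eq ..
  also have "\<dots> = (\<Sum>(k, g)\<in>{1..\<alpha>} \<times> (v \<rightarrow>\<^sub>E {1..\<alpha>}). ?h (g(j := k)))"
    using inj_combinator[OF assms(2), of "\<lambda>_. {1..\<alpha>}"]
    by (subst sum.reindex) (auto simp: case_prod_unfold)
  also have "\<dots> = (\<Sum>k=1..\<alpha>. \<Sum>g\<in>v \<rightarrow>\<^sub>E {1..\<alpha>}. ?h (g(j := k)))"
    by (rule sum.cartesian_product[symmetric])
  also have "\<dots> = (\<Sum>k=1..\<alpha>. a j k * weight \<alpha> a (s + k) v)"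
    unfolding val weight_def multi_indices_def sum_distrib_left ..
  finally show ?thesis .
qed

lemma total_weight_empty [simp]: "total_weight \<alpha> a s {} = fact s"
  by (simp add: total_weight_def weight_def multi_indices_def)

lemma total_weight_insert:
  assumes "finite F" "j \<notin> F"
  shows "total_weight \<alpha> a s (insert j F) =
    total_weight \<alpha> a s F + (\<Sum>k=1..\<alpha>. a j k * total_weight \<alpha> a (s + k) F)"
proof -
  have "total_weight \<alpha> a s (insert j F) =
      total_weight \<alpha> a s F + (\<Sum>v\<in>insert j ` Pow F. weight \<alpha> a s v)"
    unfolding total_weight_def Pow_insert using assms by (subst sum.union_disjoint) auto
  also have "(\<Sum>v\<in>insert j ` Pow F. weight \<alpha> a s v) = (\<Sum>v\<in>Pow F. weight \<alpha> a s (insert j v))"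
    using assms by (subst sum.reindex) (auto simp: inj_on_def)
  also have "\<dots> = (\<Sum>v\<in>Pow F. \<Sum>k=1..\<alpha>. a j k * weight \<alpha> a (s + k) v)"
    using assms by (intro sum.cong refl weight_insert) (auto intro: finite_subset)
  also have "\<dots> = (\<Sum>k=1..\<alpha>. a j k * total_weight \<alpha> a (s + k) F)"
    by (subst sum.swap) (simp add: total_weight_def sum_distrib_left)
  finally show ?thesis .
qed

text \<open>Induction on \<open>s\<close>, starting from the geometric sum: multiplying by
  \<open>1 - y\<close> lowers \<open>s\<close> by one, up to a boundary term of favourable sign.
  Working with partial sums avoids any convergence argument.\<close>

lemma negative_binomial_partial_sum_le:
  fixes y :: real
  assumes "0 \<le> y" "y < 1"
  shows "(\<Sum>k\<le>n. real ((s + k) choose k) * y ^ k) \<le> 1 / (1 - y) ^ Suc s"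
proof (induction s)
  case 0
  have "(\<Sum>k\<le>n. y ^ k) = (1 - y ^ Suc n) / (1 - y)"
    using assms sum_gp0[of y n] by simp
  also have "\<dots> \<le> 1 / (1 - y)"
    using assms by (intro divide_right_mono) auto
  finally show ?case by simp
next
  case (Suc s)
  have "(1 - y) * (\<Sum>k\<le>n. real ((Suc s + k) choose k) * y ^ k) =
      (\<Sum>k\<le>n. real ((s + k) choose k) * y ^ k) - real ((Suc s + n) choose n) * y ^ Suc n"
  proof (induction n)
    case 0
    show ?case by simp
  next
    case (Suc n)
    have pascal: "real ((Suc s + Suc n) choose Suc n) =
        real ((s + Suc n) choose Suc n) + real ((Suc s + n) choose n)"
      by simp
    \<comment> \<open>\<open>A\<close> and \<open>B\<close> stand for the sums up to
      \<open>n\<close> on the two sides, \<open>q\<close> and \<open>r\<close> for the two Pascal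
      summands, and \<open>Y\<close> for \<open>y ^ n\<close>; the premise is the induction
      hypothesis.\<close>
    have step: "(1 - y) * (A + (q + r) * (y * Y)) = B + q * (y * Y) - (q + r) * (y * (y * Y))"
      if "(1 - y) * A = B - r * (y * Y)" for A B q r Y :: real
      using that by algebra
    show ?case
      unfolding sum.atMost_Suc pascal power_Suc
      by (rule step) (rule Suc[unfolded power_Suc])
  qed
  also have "\<dots> \<le> (\<Sum>k\<le>n. real ((s + k) choose k) * y ^ k)"
    using assms by simp
  also note Suc
  finally have "(\<Sum>k\<le>n. real ((Suc s + k) choose k) * y ^ k) \<le> 1 / (1 - y) ^ Suc s / (1 - y)"
    using assms by (subst pos_le_divide_eq) (auto simp only: mult.commute diff_gt_0_iff_gt)
  then show ?case
    by (simp only: divide_divide_eq_left power_Suc2)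
qed

text \<open>In integral form: for \<open>k \<le> \<alpha>\<close>,
  \<open>fact k \<le> \<alpha> ^ k\<close> gives
  \<open>(b * t) ^ k \<le> (\<alpha> * b * t) ^ k / fact k\<close>, so these powers sum to at most
  \<open>exp (\<alpha> * b * t)\<close>, which turns the rate \<open>x\<close> into
  \<open>x - \<alpha> * b\<close>. The proof carries this out termwise with the negative binomial
  series at \<open>y = \<alpha> * b / x\<close>.\<close>

lemma fact_power_sum_le:
  fixes b x :: real
  assumes "0 \<le> b" "real \<alpha> * b < x"
  shows "(\<Sum>k\<le>\<alpha>. b ^ k * (fact (s + k) / x ^ Suc (s + k))) \<le> fact s / (x - real \<alpha> * b) ^ Suc s"
proof -
  define y where "y = real \<alpha> * b / x"
  have x: "x > 0"
    using assms by (smt (verit) mult_nonneg_nonneg of_nat_0_le_iff)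
  have y: "0 \<le> y" "y < 1"
    using assms x by (auto simp: y_def)
  have "b ^ k * (fact (s + k) / x ^ Suc (s + k))
      \<le> fact s / x ^ Suc s * (real ((s + k) choose k) * y ^ k)" if "k \<le> \<alpha>" for k
  proof -
    have "fact k \<le> real k ^ k"
      using fact_le_power[of k] by simp
    also have "\<dots> \<le> real \<alpha> ^ k"
      using that by (intro power_mono) auto
    finally have "fact k \<le> real \<alpha> ^ k" .
    moreover have "fact k * fact s * real ((s + k) choose k) = fact (s + k)"
      using arg_cong[OF binomial_fact_lemma[of k "s + k"], of real] by simp
    then have "fact (s + k) = real ((s + k) choose k) * fact s * fact k"
      by (metis mult.assoc mult.commute)
    ultimately have "fact (s + k) \<le> real ((s + k) choose k) * fact s * real \<alpha> ^ k"
      by (simp add: mult_left_mono)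
    then have "b ^ k / x ^ Suc (s + k) * fact (s + k)
        \<le> b ^ k / x ^ Suc (s + k) * (real ((s + k) choose k) * fact s * real \<alpha> ^ k)"
      using assms x by (intro mult_left_mono) auto
    then show ?thesis
      using x by (simp add: y_def power_mult_distrib power_divide power_add mult_ac)
  qed
  then have "(\<Sum>k\<le>\<alpha>. b ^ k * (fact (s + k) / x ^ Suc (s + k)))
      \<le> fact s / x ^ Suc s * (\<Sum>k\<le>\<alpha>. real ((s + k) choose k) * y ^ k)"
    unfolding sum_distrib_left by (intro sum_mono) auto
  also have "\<dots> \<le> fact s / x ^ Suc s * (1 / (1 - y) ^ Suc s)"
    using x y by (intro mult_left_mono negative_binomial_partial_sum_le) auto
  also have "\<dots> = fact s / (x * (1 - y)) ^ Suc s"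
    by (simp only: power_mult_distrib times_divide_times_eq mult_1_right)
  also have "x * (1 - y) = x - real \<alpha> * b"
    using x by (simp add: y_def field_simps)
  finally show ?thesis .
qed

text \<open>Each inserted index \<open>j\<close> lowers the rate by \<open>\<alpha> * b j\<close>,
  starting from 1 for the empty set. The induction keeps \<open>s\<close> arbitrary because the
  recursion calls the shifts \<open>s + k\<close>.\<close>

lemma total_weight_le:
  assumes "finite F"
    and "\<And>j k. j \<in> F \<Longrightarrow> k \<in> {1..\<alpha>} \<Longrightarrow> 0 \<le> a j k \<and> a j k \<le> b j ^ k"
    and "\<And>j. j \<in> F \<Longrightarrow> 0 \<le> b j"
    and "real \<alpha> * sum b F < 1"
  shows "total_weight \<alpha> a s F \<le> fact s / (1 - real \<alpha> * sum b F) ^ Suc s"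
  using assms
proof (induction F arbitrary: s rule: finite_induct)
  case empty
  then show ?case by simp
next
  case (insert j F)
  define x where "x = 1 - real \<alpha> * sum b F"
  have bx: "0 \<le> b j" "real \<alpha> * b j < x"
    using insert.prems insert.hyps by (auto simp: x_def algebra_simps)
  then have "0 < x"
    by (smt (verit) mult_nonneg_nonneg of_nat_0_le_iff)
  then have IH: "total_weight \<alpha> a t F \<le> fact t / x ^ Suc t" for t
    using insert.IH insert.prems unfolding x_def by simp
  have "total_weight \<alpha> a s (insert j F) =
      total_weight \<alpha> a s F + (\<Sum>k=1..\<alpha>. a j k * total_weight \<alpha> a (s + k) F)"
    using insert.hyps by (rule total_weight_insert)
  also have "\<dots> \<le> fact s / x ^ Suc s + (\<Sum>k=1..\<alpha>. b j ^ k * (fact (s + k) / x ^ Suc (s + k)))"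
  proof (intro add_mono IH sum_mono)
    fix k assume k: "k \<in> {1..\<alpha>}"
    show "a j k * total_weight \<alpha> a (s + k) F \<le> b j ^ k * (fact (s + k) / x ^ Suc (s + k))"
      by (rule order_trans[OF mult_left_mono[OF IH] mult_right_mono])
        (use k insert.prems(1)[of j k] \<open>0 < x\<close> in auto)
  qed
  \<comment> \<open>The bound for the subsets without \<open>j\<close> is exactly the missing term
    \<open>k = 0\<close>.\<close>
  also have "\<dots> = (\<Sum>k\<le>\<alpha>. b j ^ k * (fact (s + k) / x ^ Suc (s + k)))"
    by (simp add: atMost_atLeast0 sum.atLeast_Suc_atMost)
  also have "\<dots> \<le> fact s / (x - real \<alpha> * b j) ^ Suc s"
    using bx by (rule fact_power_sum_le)
  also have "x - real \<alpha> * b j = 1 - real \<alpha> * sum b (insert j F)"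
    using insert.hyps by (simp add: x_def algebra_simps)
  finally show ?case .
qed

text \<open>Indices in a fixed finite set need no smallness: each costs one use of the recursion,
  which combines finitely many bounds at higher shifts. The constant may depend on \<open>s\<close>,
  but not on \<open>G\<close>.\<close>

lemma total_weight_uniformly_bounded_union:
  assumes "finite F"
    and "\<And>j k. j \<in> F \<Longrightarrow> k \<in> {1..\<alpha>} \<Longrightarrow> 0 \<le> a j k"
    and "\<And>s. \<exists>C. \<forall>G\<in>\<G>. total_weight \<alpha> a s G \<le> C"
    and "\<And>G. G \<in> \<G> \<Longrightarrow> finite G \<and> F \<inter> G = {}"
  shows "\<exists>C. \<forall>G\<in>\<G>. total_weight \<alpha> a s (F \<union> G) \<le> C"
  using assms
proof (induction F arbitrary: s rule: finite_induct)
  case empty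
  then show ?case by simp
next
  case (insert j F)
  have "\<forall>t. \<exists>C. \<forall>G\<in>\<G>. total_weight \<alpha> a t (F \<union> G) \<le> C"
    using insert.IH insert.prems by blast
  then obtain C where C: "\<And>t G. G \<in> \<G> \<Longrightarrow> total_weight \<alpha> a t (F \<union> G) \<le> C t"
    by metis
  have "total_weight \<alpha> a s (insert j F \<union> G) \<le> C s + (\<Sum>k=1..\<alpha>. a j k * C (s + k))"
    if G: "G \<in> \<G>" for G
  proof -
    have "finite (F \<union> G)" "j \<notin> F \<union> G"
      using insert.hyps insert.prems(3)[OF G] by auto
    from total_weight_insert[OF this] show ?thesis
      by (simp only: Un_insert_left)
        (intro add_mono sum_mono mult_left_mono C G insert.prems(1), auto)
  qed
  then show ?case by blast
qed

text \<open>Choose \<open>F\<close> whose sum is within \<open>e\<close> of the total; by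
  nonnegativity, a finite set disjoint from \<open>F\<close> can only use up the remainder.\<close>

lemma summable_on_small_tail:
  fixes f :: "'a \<Rightarrow> real"
  assumes "f summable_on A" "\<And>x. x \<in> A \<Longrightarrow> f x \<ge> 0" "e > 0"
  obtains F where "finite F" "F \<subseteq> A"
    "\<And>G. finite G \<Longrightarrow> G \<subseteq> A \<Longrightarrow> F \<inter> G = {} \<Longrightarrow> sum f G \<le> e"
proof -
  obtain F where F: "finite F" "F \<subseteq> A" "dist (sum f F) (infsum f A) \<le> e"
    using infsum_finite_approximation[OF assms(1,3)] by blast
  have "sum f G \<le> e" if G: "finite G" "G \<subseteq> A" "F \<inter> G = {}" for G
  proof -
    have "sum f F + sum f G = sum f (F \<union> G)"
      using F G by (simp add: sum.union_disjoint)
    also have "\<dots> \<le> infsum f A"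
      using F G assms by (intro finite_sum_le_infsum[OF assms(1)]) auto
    finally show ?thesis
      using F(3) by (simp add: dist_real_def)
  qed
  with F that show ?thesis by blast
qed

theorem theorem4:
  fixes \<alpha> :: nat and \<Upsilon> :: "nat \<Rightarrow> nat \<Rightarrow> real"
  assumes "\<alpha> \<ge> 1"
    and "\<And>j k. j \<ge> 1 \<Longrightarrow> k \<in> {1..\<alpha>} \<Longrightarrow> \<Upsilon> j k \<ge> 0"
    and "(\<lambda>j. \<Sum>k=1..\<alpha>. \<Upsilon> j k powr (1 / real k)) summable_on {1..}"
  shows "\<forall>m::real. m > 0 \<longrightarrow>
    (\<lambda>v. m ^ card v * (\<Sum>\<nu>\<in>multi_indices \<alpha> v. fact (\<Sum>j\<in>v. \<nu> j) * (\<Prod>j\<in>v. \<Upsilon> j (\<nu> j))))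
      summable_on {v. finite v \<and> v \<subseteq> {1..}}"
proof (intro allI impI)
  fix m :: real assume m: "m > 0"
  \<comment> \<open>Since \<open>M \<ge> 1\<close>, \<open>m \<le> M \<le> M ^ k\<close> for every
    \<open>k \<ge> 1\<close>, so the single factor \<open>m\<close> in \<open>a j k\<close> fits
    into \<open>b j ^ k\<close> even when \<open>m < 1\<close>.\<close>
  define M where "M = max 1 m"
  define f where "f j = (\<Sum>k=1..\<alpha>. \<Upsilon> j k powr (1 / real k))" for j
  define a where "a j k = m * \<Upsilon> j k" for j k
  define b where "b j = M * f j" for j
  have M: "M \<ge> 1" "m \<le> M"
    by (auto simp: M_def)
  have a_nonneg: "0 \<le> a j k" if "j \<in> {1..}" "k \<in> {1..\<alpha>}" for j k
    using assms(2)[of j k] that m by (simp add: a_def)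
  have f_nonneg: "0 \<le> f j" for j
    by (simp add: f_def sum_nonneg)
  then have b_nonneg: "0 \<le> b j" for j
    using M by (simp add: b_def)
  have a_le_b: "a j k \<le> b j ^ k" if "j \<in> {1..}" "k \<in> {1..\<alpha>}" for j k
  proof -
    have "\<Upsilon> j k powr (1 / real k) \<le> f j"
      unfolding f_def using that by (intro member_le_sum) auto
    then have "(\<Upsilon> j k powr (1 / real k)) ^ k \<le> f j ^ k"
      by (rule power_mono) (rule powr_ge_zero)
    moreover have "(\<Upsilon> j k powr (1 / real k)) ^ k = \<Upsilon> j k"
      using assms(2)[of j k] that by (cases "\<Upsilon> j k = 0") (auto simp: powr_power)
    ultimately have "\<Upsilon> j k \<le> f j ^ k" by simp
    moreover have "m \<le> M ^ k"
      using M self_le_power[of M k] that by auto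
    ultimately show ?thesis
      unfolding a_def b_def power_mult_distrib
      using m M f_nonneg assms(2)[of j k] that by (intro mult_mono) auto
  qed
  \<comment> \<open>With this tail size,
    \<open>\<alpha> * sum b G = \<alpha> * M * sum f G \<le> 1 / 2\<close>, so the rate stays at
    least \<open>1 / 2\<close> for all tail sets \<open>G\<close>.\<close>
  have eps: "0 < 1 / (2 * real \<alpha> * M)"
    using assms(1) M by simp
  have "f summable_on {1..}"
    using assms(3) by (simp add: f_def[abs_def])
  then obtain F where F: "finite F" "F \<subseteq> {1..}"
    and tail: "\<And>G. finite G \<Longrightarrow> G \<subseteq> {1..} \<Longrightarrow> F \<inter> G = {} \<Longrightarrow> sum f G \<le> 1 / (2 * real \<alpha> * M)"
    by (rule summable_on_small_tail[OF _ f_nonneg eps]) (rule that)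
  define \<G> where "\<G> = {G. finite G \<and> G \<subseteq> {1..} \<and> F \<inter> G = {}}"
  have tail_bound: "total_weight \<alpha> a s G \<le> fact s / (1 / 2) ^ Suc s" if "G \<in> \<G>" for s G
  proof -
    have G: "finite G" "G \<subseteq> {1..}" "F \<inter> G = {}"
      using that by (auto simp: \<G>_def)
    have half: "real \<alpha> * sum b G \<le> 1 / 2"
      using tail[OF G] assms(1) M
      by (simp add: b_def field_simps flip: sum_distrib_left)
    have "total_weight \<alpha> a s G \<le> fact s / (1 - real \<alpha> * sum b G) ^ Suc s"
      using G half a_nonneg a_le_b b_nonneg by (intro total_weight_le) auto
    also have "\<dots> \<le> fact s / (1 / 2) ^ Suc s"
      using half by (intro divide_left_mono power_mono mult_pos_pos zero_less_power) auto
    finally show ?thesis .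
  qed
  have "\<exists>C. \<forall>G\<in>\<G>. total_weight \<alpha> a 0 (F \<union> G) \<le> C"
  proof (rule total_weight_uniformly_bounded_union)
    show "\<exists>C. \<forall>G\<in>\<G>. total_weight \<alpha> a s G \<le> C" for s
      using tail_bound by blast
  qed (use F a_nonneg in \<open>auto simp: \<G>_def\<close>)
  then obtain C where C: "\<And>G. G \<in> \<G> \<Longrightarrow> total_weight \<alpha> a 0 (F \<union> G) \<le> C"
    by blast
  have nonneg: "0 \<le> weight \<alpha> a 0 v" if "v \<subseteq> {1..}" for v
    using that by (intro weight_nonneg a_nonneg) auto
  have "sum (weight \<alpha> a 0) V \<le> C" if V: "V \<subseteq> {v. finite v \<and> v \<subseteq> {1..}}" "finite V" for V
  proof -
    \<comment> \<open>Every member of \<open>V\<close> is a subset of \<open>F \<union> G\<close>,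
      so the partial sum over \<open>V\<close> is dominated by one total weight that is bounded
      independently of \<open>V\<close>.\<close>
    define G where "G = \<Union>V - F"
    have G: "G \<in> \<G>"
      using V by (auto simp: G_def \<G>_def)
    have "sum (weight \<alpha> a 0) V \<le> total_weight \<alpha> a 0 (F \<union> G)"
      unfolding total_weight_def
    proof (rule sum_mono2)
      show "finite (Pow (F \<union> G))"
        using F G by (simp add: \<G>_def)
      show "V \<subseteq> Pow (F \<union> G)"
        by (auto simp: G_def)
      show "0 \<le> weight \<alpha> a 0 v" if "v \<in> Pow (F \<union> G) - V" for v
        using that F G by (intro nonneg) (auto simp: \<G>_def)
    qed
    with C[OF G] show ?thesis by simp
  qed
  then have "weight \<alpha> a 0 summable_on {v. finite v \<and> v \<subseteq> {1..}}"
    by (intro nonneg_bounded_partial_sums_imp_summable_on[where C = C] nonneg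
        eventually_finite_subsets_at_top_weakI) auto
  \<comment> \<open>The product of the \<open>a j (\<nu> j)\<close> contributes one factor
    \<open>m\<close> per element of \<open>v\<close>, which is \<open>m ^ card v\<close>.\<close>
  then show "(\<lambda>v. m ^ card v * (\<Sum>\<nu>\<in>multi_indices \<alpha> v. fact (\<Sum>j\<in>v. \<nu> j) * (\<Prod>j\<in>v. \<Upsilon> j (\<nu> j))))
      summable_on {v. finite v \<and> v \<subseteq> {1..}}"
    by (simp add: weight_def[abs_def] a_def prod.distrib sum_distrib_left mult_ac)
qed

end
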